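(* Let $\ell$ be a positive integer and let $x>\ell/2$ be real. Let $\rho_1(t)=\frac{\pi}{2}\operatorname{sech}^2(\pi t)$ and let $\rho_\ell$ be its $\ell$-fold convolution, i.e. $\rho_\ell(t)=\int_{-\infty}^{\infty}\rho_{\ell-1}(u)\rho_1(t-u)\,du$ for $\ell\ge2$. Then, with $b=(x-\ell/2)^{-2}$, $$\int_0^\infty \log(1+bu^2)\,\rho_\ell(u)\,du = -\log\left|x-\frac{\ell}{2}\right| - H_{\ell-1} + \frac{d^{\ell-1}}{dx^{\ell-1}}\left\{\binom{x-1}{\ell-1}\psi\!\left(x-\left\lfloor\tfrac{\ell}{2}\right\rfloor\right)\right\}.$$
   Context: $H_n$ is the $n$-th harmonic number ($H_0=0$), $\psi=\Gamma'/\Gamma$ is the digamma function, and $\binom{x}{n}=\frac{x(x-1)\cdots(x-n+1)}{n!}$ is the generalized binomial coefficient. *)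

theory Defs
  imports "HOL-Analysis.Analysis"
begin

definition rho1 :: "real \<Rightarrow> real" where
  "rho1 t = (pi / 2) * (1 / cosh (pi * t)) ^ 2"

text \<open>rho l is the l-fold convolution of rho1 (l \<ge> 1); the value at l = 0 is irrelevant.\<close>
fun rho :: "nat \<Rightarrow> real \<Rightarrow> real" where
  "rho 0 t = 0"
| "rho (Suc 0) t = rho1 t"
| "rho (Suc (Suc n)) t = (LBINT u. rho (Suc n) u * rho1 (t - u))"

end

theory Submission
  imports Defs "HOL-Probability.Distributions"
begin

text \<open>
  Write \<open>y = x - l/2\<close> and \<open>R(v) = \<integral> \<rho>\<^sub>l(t) v / (v\<^sup>2 + t\<^sup>2) dt\<close>. Since
  \<open>ln (1 + t\<^sup>2/y\<^sup>2) / 2\<close> is the integral of \<open>1/v - v/(v\<^sup>2 + t\<^sup>2)\<close> over \<open>v \<ge> y\<close> and \<open>\<rho>\<^sub>l\<close> is even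
  with total mass 1, Tonelli turns the left-hand side into the integral of \<open>1/v - R(v)\<close> over
  \<open>v \<ge> y\<close>.

  The logistic density \<open>\<rho>\<^sub>1\<close> is, up to scaling, the density of the difference of two independent
  variables with density \<open>exp (p - exp p)\<close>, whose Fourier transform is \<open>\<Gamma>(1 + iz)\<close>. The reflection
  formula therefore gives \<open>(s/2) / sinh (s/2)\<close> as the Fourier transform of \<open>\<rho>\<^sub>1\<close>, and its \<open>l\<close>-th
  power as that of \<open>\<rho>\<^sub>l\<close>. Taking the Laplace transform and expanding in powers of \<open>exp (-s)\<close>
  shows \<open>R(v) = (\<Sum>N. ((N + l - 1) choose (l - 1)) l! / (v + l/2 + N)^(l + 1))\<close>.

  The same series is the \<open>l\<close>-th derivative at \<open>v + l/2\<close> of the function in braces on the right-hand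
  side: after Leibniz' rule, the \<open>n\<close>-th terms of the polygamma series add up to a Taylor expansion
  that evaluates the binomial polynomial at an integer. Hence \<open>ln v\<close> minus the \<open>(l-1)\<close>-st derivative
  is an antiderivative of \<open>1/v - R(v)\<close>. Its limit at infinity, found from the leading terms of the
  polygamma functions, is \<open>-harm (l - 1)\<close>.
\<close>

subsection \<open>The Fourier transform of the logistic density\<close>

lemma borel_measurable_cis [measurable]: "cis \<in> borel_measurable borel"
  unfolding cis_conv_exp[abs_def] by measurable

text \<open>No normalising factor is used, so convolutions go to plain products and
  \<open>fourier f 0\<close> is the total mass.\<close>

definition fourier :: "(real \<Rightarrow> real) \<Rightarrow> real \<Rightarrow> complex" where
  "fourier f s = (LINT t|lborel. of_real (f t) * cis (s * t))"

definition convol :: "(real \<Rightarrow> real) \<Rightarrow> (real \<Rightarrow> real) \<Rightarrow> real \<Rightarrow> real" where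
  "convol f g t = (LINT u|lborel. f u * g (t - u))"

lemma lborel_integral_shift:
  fixes h :: "real \<Rightarrow> 'a :: {banach, second_countable_topology}"
  shows "(LINT t|lborel. h (t - u)) = (LINT t|lborel. h t)"
  using lborel_integral_real_affine[of 1 h "- u"] by simp

lemma lborel_integrable_shift:
  fixes h :: "real \<Rightarrow> 'a :: {banach, second_countable_topology}"
  shows "integrable lborel (\<lambda>t. h (t - u)) \<longleftrightarrow> integrable lborel h"
  using lborel_integrable_real_affine_iff[of 1 h "- u"] by simp

text \<open>Both claims come from Fubini applied to f(u) g(t - u) exp(i s t) on the plane, whose
  absolute integral is the product of the two L1 norms.\<close>

lemma
  assumes f: "integrable lborel f" and g: "integrable lborel g"
  shows integrable_convol: "integrable lborel (convol f g)"
    and fourier_convol: "fourier (convol f g) s = fourier f s * fourier g s"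
proof -
  have [measurable]: "f \<in> borel_measurable borel" "g \<in> borel_measurable borel"
    using f g by auto
  define F where "F s = (\<lambda>(u::real, t::real). complex_of_real (f u) * of_real (g (t - u)) * cis (s * t))" for s
  have F_meas [measurable]: "F s \<in> borel_measurable (lborel \<Otimes>\<^sub>M lborel)" for s
    unfolding F_def by measurable
  have g_shift: "integrable lborel (\<lambda>t. g (t - u))" for u
    using g by (simp add: lborel_integrable_shift)
  have F_int: "integrable (lborel \<Otimes>\<^sub>M lborel) (F s)" for s
  proof (rule lborel_pair.Fubini_integrable)
    have "(LINT t|lborel. norm (F s (u, t))) = \<bar>f u\<bar> * (LINT t|lborel. \<bar>g t\<bar>)" for u
      by (simp add: F_def norm_mult lborel_integral_shift[of "\<lambda>t. \<bar>g t\<bar>" u])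
    then show "integrable lborel (\<lambda>u. LINT t|lborel. norm (F s (u, t)))"
      using f by simp
    have "integrable lborel (\<lambda>t. F s (u, t))" for u
      unfolding F_def
      by (rule Bochner_Integration.integrable_bound[OF integrable_mult_right[OF g_shift[of u], of "f u"]])
        (auto simp: norm_mult abs_mult)
    then show "AE u in lborel. integrable lborel (\<lambda>t. F s (u, t))" by simp
  qed simp
  have inner: "(LINT u|lborel. F s (u, t)) = of_real (convol f g t) * cis (s * t)" for s t
    by (simp add: F_def convol_def flip: integral_complex_of_real of_real_mult)
  have int: "integrable lborel (\<lambda>t. of_real (convol f g t) * cis (s * t))" for s
    using lborel_pair.integrable_snd[of "\<lambda>u t. F s (u, t)"] F_int[of s] by (simp add: inner)
  \<comment> \<open>At s = 0 the factor \<open>cis\<close> is 1, so the same argument yields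
    integrability of the convolution itself.\<close>
  from integrable_Re[OF int[of 0]] show "integrable lborel (convol f g)" by simp
  have "fourier (convol f g) s = (LINT t|lborel. LINT u|lborel. F s (u, t))"
    by (simp add: fourier_def inner)
  also have "\<dots> = (LINT u|lborel. LINT t|lborel. F s (u, t))"
    using F_int[of s] by (intro lborel_pair.Fubini_integral) simp
  also have "\<dots> = (LINT u|lborel. of_real (f u) * cis (s * u) * fourier g s)"
  proof (rule Bochner_Integration.integral_cong[OF refl])
    fix u
    have "(LINT t|lborel. F s (u, t)) = (LINT t|lborel. of_real (f u) * cis (s * u) * (of_real (g (t - u)) * cis (s * (t - u))))"
      by (intro Bochner_Integration.integral_cong) (auto simp: F_def cis_mult algebra_simps)
    also have "\<dots> = of_real (f u) * cis (s * u) * (LINT t|lborel. of_real (g (t - u)) * cis (s * (t - u)))"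
      by simp
    finally show "(LINT t|lborel. F s (u, t)) = of_real (f u) * cis (s * u) * fourier g s"
      unfolding lborel_integral_shift[of "\<lambda>t. of_real (g t) * cis (s * t)" u] fourier_def .
  qed
  finally show "fourier (convol f g) s = fourier f s * fourier g s"
    by (simp add: fourier_def)
qed

section \<open>The log-exponential density and the gamma function\<close>

text \<open>The density of the logarithm of a standard exponential variable.\<close>

definition gumbel :: "real \<Rightarrow> real" where
  "gumbel p = exp (p - exp p)"

lemma
  fixes c :: real assumes c: "c > 0"
  shows integrable_exp_exp1: "integrable lborel (\<lambda>p. exp (p - c * exp p))"
    and integral_exp_exp2: "(LINT p|lborel. exp (2 * p - c * exp p)) = 1 / c ^ 2"
proof -
  have "set_integrable lborel (einterval (-\<infinity>) \<infinity>) (\<lambda>p. exp (p - c * exp p))"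
  proof (rule interval_integral_FTC_nonneg[where F = "\<lambda>p. - exp (- c * exp p) / c"])
    show "(((\<lambda>p. - exp (- c * exp p) / c) \<circ> real_of_ereal) \<longlongrightarrow> - inverse c) (at_right (-\<infinity>))"
      unfolding ereal_tendsto_simps using c by real_asymp
    show "(((\<lambda>p. - exp (- c * exp p) / c) \<circ> real_of_ereal) \<longlongrightarrow> 0) (at_left \<infinity>)"
      unfolding ereal_tendsto_simps using c by real_asymp
  qed (use c in \<open>auto intro!: derivative_eq_intros continuous_intros simp: exp_diff exp_minus field_simps\<close>)
  then show "integrable lborel (\<lambda>p. exp (p - c * exp p))"
    by (simp add: set_integrable_def)
  let ?F = "\<lambda>p. - (exp p / c + 1 / c ^ 2) * exp (- c * exp p)"
  have D: "(?F has_real_derivative exp (2 * p - c * exp p)) (at p)" for p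
  proof -
    have "exp (p * 2) = exp p * exp p" by (simp flip: exp_add)
    then show ?thesis
      using c by (auto intro!: derivative_eq_intros simp: exp_diff exp_minus power2_eq_square field_simps)
  qed
  have L: "((?F \<circ> real_of_ereal) \<longlongrightarrow> - (1 / c ^ 2)) (at_right (-\<infinity>))"
    unfolding ereal_tendsto_simps using c by real_asymp
  have R: "((?F \<circ> real_of_ereal) \<longlongrightarrow> 0) (at_left \<infinity>)"
    unfolding ereal_tendsto_simps using c by real_asymp
  have C: "isCont (\<lambda>p. exp (2 * p - c * exp p)) p" for p by (intro continuous_intros)
  have "(LBINT p=-\<infinity>..\<infinity>. exp (2 * p - c * exp p)) = 0 - (- (1 / c ^ 2))"
    using interval_integral_FTC_nonneg(2)[OF _ D C _ L R] by auto
  then show "(LINT p|lborel. exp (2 * p - c * exp p)) = 1 / c ^ 2"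
    by (simp add: interval_lebesgue_integral_def set_lebesgue_integral_def)
qed

lemma integrable_gumbel: "integrable lborel gumbel"
  using integrable_exp_exp1[of 1] by (simp add: gumbel_def[abs_def])

lemma fourier_gumbel: "fourier gumbel z = Gamma (1 + \<i> * of_real z)"
proof -
  let ?f = "\<lambda>t. complex_of_real t powr (\<i> * of_real z) / of_real (exp t)"
  have "?f absolutely_integrable_on {0<..}"
    using absolutely_integrable_Gamma_integral'[of "1 + \<i> * of_real z"] by simp
  moreover have cont: "continuous_on {0<..} ?f"
    by (intro continuous_intros) (auto simp: complex_nonpos_Reals_iff)
  \<comment> \<open>The gamma integral is taken over the completed measure; continuity on the
    half-line supplies the Borel measurability for passing to \<open>lborel\<close>.\<close>
  ultimately have f: "set_integrable lborel {0<..} ?f"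
    unfolding set_integrable_def
    by (subst (asm) integrable_completion)
      (auto intro!: borel_measurable_continuous_on_indicator)
  have G: "(LBINT t:{0<..}. ?f t) = Gamma (1 + \<i> * of_real z)"
    using set_borel_integral_eq_integral(2)[OF f]
      Gamma_integral_complex'[of "1 + \<i> * of_real z"] by (simp add: integral_unique)
  have e0: "einterval 0 \<infinity> = {0<..}" by (auto simp: einterval_def)
  \<comment> \<open>The Jacobian of t = exp x completes exp (- t) to \<open>gumbel\<close>, and t to
    the power iz becomes \<open>cis (z * x)\<close>.\<close>
  have eq: "exp x *\<^sub>R ?f (exp x) = of_real (gumbel x) * cis (z * x)" for x
    by (simp add: powr_def gumbel_def cis_conv_exp exp_diff scaleR_conv_of_real mult_ac flip: Ln_of_real exp_of_real)
  have "(LBINT x=0..\<infinity>. ?f x) = (LBINT x=-\<infinity>..\<infinity>. exp x *\<^sub>R ?f (exp x))"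
  proof (rule interval_integral_substitution_integrable)
    show "set_integrable lborel (einterval (-\<infinity>) \<infinity>) (\<lambda>x. exp x *\<^sub>R ?f (exp x))"
      unfolding eq set_integrable_def
      by (rule Bochner_Integration.integrable_bound[OF integrable_gumbel])
         (auto simp: norm_mult gumbel_def[abs_def])
    show "((ereal \<circ> exp \<circ> real_of_ereal) \<longlongrightarrow> 0) (at_right (-\<infinity>))"
      unfolding zero_ereal_def ereal_tendsto_simps by (rule exp_at_bot)
    show "((ereal \<circ> exp \<circ> real_of_ereal) \<longlongrightarrow> \<infinity>) (at_left \<infinity>)"
      unfolding ereal_tendsto_simps by (rule exp_at_top)
  qed (use f in \<open>auto simp: e0 complex_nonpos_Reals_iff intro!: derivative_eq_intros continuous_intros\<close>)
  then show ?thesis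
    unfolding eq using G
    by (simp add: interval_lebesgue_integral_def e0 fourier_def set_lebesgue_integral_def)
qed

text \<open>The exponents collect to the integral \<open>integral_exp_exp2\<close> with c = 1 + exp
  (- t); pulling out exp (- t / 2) then makes the quotient symmetric in t.\<close>

lemma convol_gumbel:
  "convol gumbel (\<lambda>v. gumbel (- v)) t = 1 / (2 * cosh (t / 2)) ^ 2"
proof -
  have "convol gumbel (\<lambda>v. gumbel (- v)) t
      = (LINT u|lborel. exp (- t) * exp (2 * u - (1 + exp (- t)) * exp u))"
    unfolding convol_def gumbel_def
    by (intro Bochner_Integration.integral_cong)
      (auto simp: algebra_simps simp flip: exp_add)
  also have "\<dots> = exp (- t) / (1 + exp (- t)) ^ 2"
    by (simp add: integral_exp_exp2 add_pos_pos)
  also have "exp (- t) = exp (- t / 2) ^ 2" by (simp add: exp_double flip: exp_of_nat_mult)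
  also have "exp (- t / 2) ^ 2 / (1 + exp (- t / 2) ^ 2) ^ 2 = 1 / (2 * cosh (t / 2)) ^ 2"
  proof -
    have *: "1 + exp (- t / 2) ^ 2 = 2 * cosh (t / 2) * exp (- t / 2)"
      by (simp add: cosh_def algebra_simps power2_eq_square flip: exp_add)
    show ?thesis
      unfolding * by (simp add: power_mult_distrib)
  qed
  finally show ?thesis .
qed

lemma rho1_eq_convol:
  "rho1 t = 2 * pi * convol gumbel (\<lambda>v. gumbel (- v)) (2 * pi * t)"
  unfolding convol_gumbel rho1_def by (simp add: power_mult_distrib power_divide)

lemma fourier_reflect: "fourier (\<lambda>v. f (- v)) s = fourier f (- s)"
  unfolding fourier_def
  using lborel_integral_real_affine[of "- 1" "\<lambda>t. of_real (f t) * cis (- s * t)" 0] by simp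

lemma integrable_reflect:
  fixes f :: "real \<Rightarrow> real"
  shows "integrable lborel f \<Longrightarrow> integrable lborel (\<lambda>v. f (- v))"
  using lborel_integrable_real_affine[of f "- 1" 0] by simp

lemma integrable_rho1: "integrable lborel rho1"
proof -
  have "integrable lborel (convol gumbel (\<lambda>v. gumbel (- v)))"
    by (intro integrable_convol integrable_gumbel integrable_reflect)
  from lborel_integrable_real_affine[OF this, of "2 * pi" 0] show ?thesis
    unfolding rho1_eq_convol[abs_def] by simp
qed

text \<open>The reflected density contributes the second gamma factor, and the scaling by 2 pi
  divides the frequency.\<close>

lemma fourier_rho1_Gamma:
  "fourier rho1 s = Gamma (1 + \<i> * of_real (s / (2 * pi))) * Gamma (1 - \<i> * of_real (s / (2 * pi)))"
proof -
  let ?k = "convol gumbel (\<lambda>v. gumbel (- v))"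
  have "fourier ?k (s / (2 * pi)) = fourier rho1 s"
    unfolding fourier_def rho1_eq_convol
    by (subst lborel_integral_real_affine[of "2 * pi" _ 0])
      (simp_all add: scaleR_conv_of_real mult_ac flip: integral_mult_right_zero)
  then show ?thesis
    by (simp add: fourier_convol integrable_gumbel integrable_reflect fourier_reflect fourier_gumbel)
qed

lemma fourier_rho1_0: "fourier rho1 0 = 1"
  by (simp add: fourier_rho1_Gamma)

text \<open>The gamma values at 1 + z and 1 - z combine by the recurrence and the reflection
  formula. At s = 0 the closed form would be 0 / 0, which is 0 here, while the true value is
  1.\<close>

lemma fourier_rho1:
  assumes "s \<noteq> 0"
  shows "fourier rho1 s = of_real ((s / 2) / sinh (s / 2))"
proof -
  define z where "z = \<i> * complex_of_real (s / (2 * pi))"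
  have z: "z \<notin> \<int>\<^sub>\<le>\<^sub>0" "z \<noteq> 0"
    using assms by (auto simp: z_def complex_eq_iff elim!: nonpos_Ints_cases)
  have "fourier rho1 s = z * (Gamma z * Gamma (1 - z))"
    using z Gamma_plus1[of z] unfolding fourier_rho1_Gamma z_def[symmetric] by (simp add: add.commute)
  also have "Gamma z * Gamma (1 - z) = of_real pi / sin (of_real pi * z)"
    by (rule Gamma_reflection_complex)
  also have "of_real pi * z = \<i> * of_real (s / 2)" by (simp add: z_def)
  also have "sin (\<i> * of_real (s / 2)) = \<i> * of_real (sinh (s / 2))"
    unfolding sinh_def sin_i_times by (simp add: scaleR_conv_of_real exp_minus flip: exp_of_real)
  finally show ?thesis using assms by (simp add: z_def field_simps)
qed

section \<open>Elementary properties of the convolution powers\<close>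

lemma rho_Suc_Suc: "rho (Suc (Suc n)) = convol (rho (Suc n)) rho1"
  by (simp add: fun_eq_iff convol_def)

lemma rho1_nonneg: "0 \<le> rho1 t"
  by (simp add: rho1_def)

lemma rho1_minus: "rho1 (- t) = rho1 t"
  by (simp add: rho1_def)

lemma rho_Suc_0: "rho (Suc 0) = rho1"
  by (simp add: fun_eq_iff)

lemma integrable_rho: "integrable lborel (rho (Suc n))"
  by (induction n) (simp_all add: rho_Suc_0 rho_Suc_Suc integrable_rho1 integrable_convol)

lemma borel_measurable_rho [measurable]: "rho (Suc n) \<in> borel_measurable borel"
  using integrable_rho[of n] by auto

lemma fourier_rho: "fourier (rho (Suc n)) s = fourier rho1 s ^ Suc n"
proof (induction n)
  case (Suc n)
  then show ?case
    unfolding rho_Suc_Suc by (simp add: fourier_convol integrable_rho integrable_rho1)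
qed (simp add: rho_Suc_0)

lemma rho_nonneg: "0 \<le> rho (Suc n) t"
proof (induction n arbitrary: t)
  case (Suc n)
  then show ?case
    by (simp add: Bochner_Integration.integral_nonneg rho1_nonneg)
qed (simp add: rho1_nonneg)

lemma rho_minus: "rho (Suc n) (- t) = rho (Suc n) t"
proof (induction n arbitrary: t)
  case (Suc n)
  have "rho (Suc (Suc n)) (- t) = (LINT u|lborel. rho (Suc n) (- u) * rho1 (- t + u))"
    using lborel_integral_real_affine[of "- 1" "\<lambda>u. rho (Suc n) u * rho1 (- t - u)" 0] by simp
  also have "\<dots> = rho (Suc (Suc n)) t"
    using rho1_minus[of "t - u" for u] by (simp add: Suc.IH)
  finally show ?case .
qed (simp add: rho1_minus)

subsection \<open>The Cauchy transform of the convolution powers\<close>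

text \<open>The Laplace transform of a cosine: it writes the Cauchy kernel as a superposition of
  cosines, so integrating that kernel against a density brings in the Fourier transform.\<close>

lemma
  fixes v t :: real
  assumes v: "v > 0"
  shows set_integrable_exp_cos: "set_integrable lborel {0<..} (\<lambda>s. exp (- s * v) * cos (s * t))"
    and integral_exp_cos: "(LBINT s:{0<..}. exp (- s * v) * cos (s * t)) = v / (v\<^sup>2 + t\<^sup>2)"
proof -
  have e0: "einterval 0 \<infinity> = {0<..}" by (auto simp: einterval_def)
  have "set_integrable lborel (einterval 0 \<infinity>) (\<lambda>s. exp (- s * v))"
  proof (rule interval_integral_FTC_nonneg[where F = "\<lambda>s. - exp (- s * v) / v"])
    show "(((\<lambda>s. - exp (- s * v) / v) \<circ> real_of_ereal) \<longlongrightarrow> - inverse v) (at_right 0)"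
      unfolding zero_ereal_def ereal_tendsto_simps using v by real_asymp
    show "(((\<lambda>s. - exp (- s * v) / v) \<circ> real_of_ereal) \<longlongrightarrow> 0) (at_left \<infinity>)"
      unfolding ereal_tendsto_simps using v by real_asymp
  qed (use v in \<open>auto intro!: derivative_eq_intros continuous_intros\<close>)
  then have i0: "set_integrable lborel {0<..} (\<lambda>s. exp (- s * v))" by (simp add: e0)
  show int: "set_integrable lborel {0<..} (\<lambda>s. exp (- s * v) * cos (s * t))"
    by (rule set_integrable_bound[OF i0])
      (auto simp: set_borel_measurable_def abs_mult mult_left_le)
  \<comment> \<open>The real part of
    \<open>- exp (- s * (v - \<i> * t)) / (v - \<i> * t)\<close>.\<close>
  let ?F = "\<lambda>s. exp (- s * v) * (t * sin (s * t) - v * cos (s * t)) / (v\<^sup>2 + t\<^sup>2)"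
  have vt: "v\<^sup>2 + t\<^sup>2 > 0" using v by (intro add_pos_nonneg) auto
  have D: "(?F has_vector_derivative exp (- s * v) * cos (s * t)) (at s)" for s
  proof -
    have "((\<lambda>s. exp (- s * v) * (t * sin (s * t) - v * cos (s * t))) has_real_derivative
        exp (- s * v) * cos (s * t) * (v\<^sup>2 + t\<^sup>2)) (at s)"
      by (auto intro!: derivative_eq_intros simp: algebra_simps power2_eq_square)
    from DERIV_cdivide[OF this, of "v\<^sup>2 + t\<^sup>2"] show ?thesis
      unfolding has_real_derivative_iff_has_vector_derivative[symmetric] using v by simp
  qed
  have "isCont ?F 0" by (intro DERIV_isCont[OF D[unfolded has_real_derivative_iff_has_vector_derivative[symmetric]]])
  then have L: "((?F \<circ> real_of_ereal) \<longlongrightarrow> - v / (v\<^sup>2 + t\<^sup>2)) (at_right 0)"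
    unfolding zero_ereal_def ereal_tendsto_simps
    by (simp add: isCont_def filterlim_at_split)
  have "((\<lambda>s. exp (- s * v)) \<longlongrightarrow> 0) at_top" using v by real_asymp
  from tendsto_mult_left_zero[OF this, of "(\<bar>t\<bar> + v) / (v\<^sup>2 + t\<^sup>2)"]
  have "(?F \<longlongrightarrow> 0) at_top"
  proof (rule Lim_null_comparison[rotated])
    have "\<bar>t * sin (s * t) - v * cos (s * t)\<bar> \<le> \<bar>t\<bar> + v" for s
    proof -
      have "\<bar>t * sin (s * t)\<bar> \<le> \<bar>t\<bar>" "\<bar>v * cos (s * t)\<bar> \<le> v"
        using v by (auto simp: abs_mult mult_left_le)
      then show ?thesis by linarith
    qed
    then show "\<forall>\<^sub>F s in at_top. norm (?F s) \<le> exp (- s * v) * ((\<bar>t\<bar> + v) / (v\<^sup>2 + t\<^sup>2))"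
      using vt by (intro always_eventually allI)
        (simp add: abs_mult divide_right_mono)
  qed
  then have R: "((?F \<circ> real_of_ereal) \<longlongrightarrow> 0) (at_left \<infinity>)"
    unfolding ereal_tendsto_simps .
  have "(LBINT s=0..\<infinity>. exp (- s * v) * cos (s * t)) = 0 - (- v / (v\<^sup>2 + t\<^sup>2))"
    by (rule interval_integral_FTC_integrable[OF _ D _ _ L R]) (use int in \<open>auto simp: e0\<close>)
  then show "(LBINT s:{0<..}. exp (- s * v) * cos (s * t)) = v / (v\<^sup>2 + t\<^sup>2)"
    by (simp add: interval_lebesgue_integral_def e0)
qed

lemma Re_fourier:
  assumes "integrable lborel f"
  shows "Re (fourier f s) = (LINT t|lborel. f t * cos (s * t))"
proof -
  have [measurable]: "f \<in> borel_measurable borel" using assms by auto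
  have "integrable lborel (\<lambda>t. of_real (f t) * cis (s * t))"
    by (rule Bochner_Integration.integrable_bound[OF assms]) (auto simp: norm_mult)
  then show ?thesis
    unfolding fourier_def by (subst integral_Re[symmetric]) auto
qed

text \<open>Fubini for f(t) exp (- s v) cos (s t), dominated by |f(t)| exp (- s v): integrating
  first in t gives the Fourier transform, first in s the Cauchy kernel.\<close>

lemma
  assumes f: "integrable lborel f" and v: "v > 0"
  shows integrable_laplace_fourier:
      "set_integrable lborel {0<..} (\<lambda>s. exp (- s * v) * Re (fourier f s))" (is ?A)
    and integral_laplace_fourier:
      "(LBINT s:{0<..}. exp (- s * v) * Re (fourier f s)) = (LINT t|lborel. f t * (v / (v\<^sup>2 + t\<^sup>2)))" (is ?B)
proof -
  have [measurable]: "f \<in> borel_measurable borel" using f by auto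
  define F where "F = (\<lambda>(t::real, s::real). f t * (indicator {0<..} s * (exp (- s * v) * cos (s * t))))"
  have [measurable]: "F \<in> borel_measurable (lborel \<Otimes>\<^sub>M lborel)"
    unfolding F_def by measurable
  have F_int: "integrable (lborel \<Otimes>\<^sub>M lborel) F"
  proof (rule lborel_pair.Fubini_integrable)
    have ie: "integrable lborel (\<lambda>s. indicator {0<..} s * exp (- s * v))"
      using set_integrable_exp_cos[OF v, of 0] by (simp add: set_integrable_def)
    have icos: "integrable lborel (\<lambda>s. indicator {0<..} s * (exp (- s * v) * cos (s * t)))" for t
      using set_integrable_exp_cos[OF v, of t] by (simp add: set_integrable_def)
    show "AE t in lborel. integrable lborel (\<lambda>s. F (t, s))"
      using icos by (simp add: F_def)
    show "integrable lborel (\<lambda>t. LINT s|lborel. norm (F (t, s)))"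
    proof (rule Bochner_Integration.integrable_bound)
      show "integrable lborel (\<lambda>t. \<bar>f t\<bar> * (LINT s|lborel. indicator {0<..} s * exp (- s * v)))"
        using f by simp
      have "(LINT s|lborel. norm (F (t, s))) \<le> \<bar>f t\<bar> * (LINT s|lborel. indicator {0<..} s * exp (- s * v))" for t
      proof -
        have "(LINT s|lborel. norm (F (t, s))) \<le> (LINT s|lborel. \<bar>f t\<bar> * (indicator {0<..} s * exp (- s * v)))"
        proof (rule integral_mono)
          show "integrable lborel (\<lambda>s. norm (F (t, s)))"
            using icos[of t] by (simp add: F_def)
          show "norm (F (t, s)) \<le> \<bar>f t\<bar> * (indicator {0<..} s * exp (- s * v))" for s
            by (auto simp: F_def abs_mult indicator_def intro!: mult_left_mono mult_left_le)
        qed (use ie in simp)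
        then show ?thesis by simp
      qed
      then show "AE t in lborel. norm (LINT s|lborel. norm (F (t, s)))
          \<le> norm (\<bar>f t\<bar> * (LINT s|lborel. indicator {0<..} s * exp (- s * v)))"
        by (auto intro!: order_trans[OF _ abs_ge_self])
    qed simp
  qed simp
  have t: "(LINT t|lborel. F (t, s)) = indicator {0<..} s *\<^sub>R (exp (- s * v) * Re (fourier f s))" for s
  proof -
    have "(LINT t|lborel. F (t, s)) = (LINT t|lborel. (indicator {0<..} s * exp (- s * v)) * (f t * cos (s * t)))"
      by (intro Bochner_Integration.integral_cong) (auto simp: F_def)
    then show ?thesis by (simp add: Re_fourier[OF f])
  qed
  have s: "(LINT s|lborel. F (t, s)) = f t * (v / (v\<^sup>2 + t\<^sup>2))" for t
    using integral_exp_cos[OF v, of t] by (simp add: F_def set_lebesgue_integral_def)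
  show ?A
    using lborel_pair.integrable_snd[of "\<lambda>t s. F (t, s)"] F_int by (simp add: t set_integrable_def)
  show ?B
    using lborel_pair.Fubini_integral[of "\<lambda>t s. F (t, s)"] F_int
    by (simp add: t s set_lebesgue_integral_def)
qed

section \<open>Expansion of the transform in exponentials\<close>

text \<open>Up to a constant factor the integrand is an Erlang density, whose zeroth moment is 1.
  For n = 0 the two differ at s = 0, hence the almost-everywhere comparison.\<close>

lemma nn_integral_power_exp:
  fixes a :: real assumes "a > 0"
  shows "(\<integral>\<^sup>+s. ennreal (indicator {0<..} s * (s ^ n * exp (- s * a))) \<partial>lborel) = ennreal (fact n / a ^ Suc n)"
proof -
  have "(\<integral>\<^sup>+s. ennreal (indicator {0<..} s * (s ^ n * exp (- s * a))) \<partial>lborel)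
      = (\<integral>\<^sup>+s. ennreal (fact n / a ^ Suc n) * ennreal (erlang_density n a s * s ^ 0) \<partial>lborel)"
  proof (rule nn_integral_cong_AE[OF AE_mp[OF AE_lborel_singleton[of 0] AE_I2]], rule impI)
    fix s :: real assume "s \<noteq> 0"
    have "indicator {0<..} s * (s ^ n * exp (- s * a)) = fact n / a ^ Suc n * (erlang_density n a s * s ^ 0)"
    proof (cases "s < 0")
      case False
      with \<open>s \<noteq> 0\<close> have "s > 0" by simp
      have "fact n / a ^ Suc n * ((a ^ Suc n * s ^ n * exp (- a * s)) / fact n) = s ^ n * exp (- s * a)"
        using assms by (simp add: mult.commute[of s a])
      with \<open>s > 0\<close> show ?thesis unfolding erlang_density_def by simp
    qed (simp add: erlang_density_def)
    with assms show "ennreal (indicator {0<..} s * (s ^ n * exp (- s * a))) = ennreal (fact n / a ^ Suc n) * ennreal (erlang_density n a s * s ^ 0)"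
      by (subst ennreal_mult'[symmetric]) auto
  qed
  also have "\<dots> = ennreal (fact n / a ^ Suc n) * (\<integral>\<^sup>+s. ennreal (erlang_density n a s * s ^ 0) \<partial>lborel)"
    by (rule nn_integral_cmult) simp
  also have "\<dots> = ennreal (fact n / a ^ Suc n)"
    unfolding nn_integral_erlang_ith_moment[OF assms] by simp
  finally show ?thesis .
qed

text \<open>Newton's binomial series with exponent - (k + 1), after upper negation of the
  coefficients.\<close>

lemma negative_binomial_sums:
  fixes r :: real
  assumes "\<bar>r\<bar> < 1"
  shows "(\<lambda>N. real ((N + k) choose k) * r ^ N) sums (1 / (1 - r) ^ Suc k)"
proof -
  have "(- real (Suc k) gchoose N) * (- r) ^ N = real ((N + k) choose k) * r ^ N" for N
  proof -
    have "(- real (Suc k) gchoose N) = (- 1) ^ N * (real (N + k) gchoose N)"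
      by (subst gbinomial_minus) (simp add: add.commute)
    also have "real (N + k) gchoose N = real ((N + k) choose k)"
      using binomial_symmetric[of k "N + k"] by (simp add: binomial_gbinomial)
    finally have "(- real (Suc k) gchoose N) * (- r) ^ N
        = ((- 1) ^ N * (- 1) ^ N) * (real ((N + k) choose k) * r ^ N)"
      unfolding power_minus[of r N] by (simp only: mult_ac)
    also have "(- 1) ^ N * (- 1) ^ N = (1 :: real)"
      by (simp flip: power_mult_distrib)
    finally show ?thesis by simp
  qed
  moreover have "(1 - r) powr (- real (Suc k)) = 1 / (1 - r) ^ Suc k"
    using assms powr_realpow[of "1 - r" "Suc k"] unfolding powr_minus_divide by simp
  ultimately show ?thesis
    using gen_binomial_real[of "- r" "- real (Suc k)"] assms by (simp del: of_nat_Suc)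
qed

text \<open>With r = exp (- s) the base of the power is s exp (- s / 2) / (1 - r), so the negative
  binomial series in r applies.\<close>

lemma sinh_kernel_sums:
  fixes s :: real
  assumes s: "s > 0"
  shows "(\<lambda>N. real ((N + k) choose k) * (s ^ Suc k * exp (- s * (real (Suc k) / 2 + real N))))
    sums ((s / 2) / sinh (s / 2)) ^ Suc k"
proof -
  define r where "r = exp (- s)"
  have r: "0 < r" "r < 1" using s by (auto simp: r_def)
  have "(\<lambda>N. (s * exp (- s / 2)) ^ Suc k * (real ((N + k) choose k) * r ^ N))
      sums ((s * exp (- s / 2)) ^ Suc k * (1 / (1 - r) ^ Suc k))"
    using r by (intro sums_mult negative_binomial_sums) simp
  also have "(s * exp (- s / 2)) ^ Suc k * (1 / (1 - r) ^ Suc k) = (s * exp (- s / 2) / (1 - r)) ^ Suc k"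
    by (simp add: power_divide)
  also have "s * exp (- s / 2) / (1 - r) = (s / 2) / sinh (s / 2)"
  proof -
    have *: "1 - r = 2 * sinh (s / 2) * exp (- s / 2)"
      by (simp add: sinh_def r_def algebra_simps flip: exp_add)
    show ?thesis unfolding * by simp
  qed
  also have "(\<lambda>N. (s * exp (- s / 2)) ^ Suc k * (real ((N + k) choose k) * r ^ N))
      = (\<lambda>N. real ((N + k) choose k) * (s ^ Suc k * exp (- s * (real (Suc k) / 2 + real N))))"
  proof
    fix N
    have "exp (- s * (real (Suc k) / 2 + real N)) = exp (real (Suc k) * (- s / 2) + real N * (- s))"
      by (rule arg_cong[where f = exp]) (simp add: field_simps)
    then have e: "exp (- s * (real (Suc k) / 2 + real N)) = exp (- s / 2) ^ Suc k * r ^ N"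
      unfolding exp_add exp_of_nat_mult r_def .
    show "(s * exp (- s / 2)) ^ Suc k * (real ((N + k) choose k) * r ^ N)
        = real ((N + k) choose k) * (s ^ Suc k * exp (- s * (real (Suc k) / 2 + real N)))"
      unfolding e power_mult_distrib by (simp only: mult_ac)
  qed
  finally show ?thesis .
qed

text \<open>The expansion of the Fourier transform is integrated termwise against exp (- s v). All
  terms are nonnegative, so the interchange in \<open>ennreal\<close> asks for no convergence
  bounds.\<close>

lemma rho_cauchy_transform_sums:
  fixes v :: real
  assumes v: "v > 0"
  shows "(\<lambda>N. real ((N + k) choose k) * fact (Suc k) / (v + real (Suc k) / 2 + real N) ^ Suc (Suc k))
    sums (LINT t|lborel. rho (Suc k) t * (v / (v\<^sup>2 + t\<^sup>2)))"
proof -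
  let ?J = "LINT t|lborel. rho (Suc k) t * (v / (v\<^sup>2 + t\<^sup>2))"
  let ?a = "\<lambda>N. real ((N + k) choose k) * fact (Suc k) / (v + real (Suc k) / 2 + real N) ^ Suc (Suc k)"
  let ?h = "\<lambda>s. indicator {0<..} s * (exp (- s * v) * Re (fourier (rho (Suc k)) s))"
  let ?g = "\<lambda>N s. real ((N + k) choose k) * (indicator {0<..} s * (s ^ Suc k * exp (- s * (v + real (Suc k) / 2 + real N))))"
  have J: "?J \<ge> 0"
    using v by (intro Bochner_Integration.integral_nonneg mult_nonneg_nonneg rho_nonneg) auto
  have pos: "v + real (Suc k) / 2 + real N > 0" for N
    using v by (auto intro!: add_pos_nonneg)
  have h: "?g N s \<ge> 0" "(\<lambda>N. ?g N s) sums ?h s" for N s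
  proof -
    show "?g N s \<ge> 0" by (auto simp: indicator_def)
    show "(\<lambda>N. ?g N s) sums ?h s"
    proof (cases "s > 0")
      case True
      have "Re (fourier (rho (Suc k)) s) = ((s / 2) / sinh (s / 2)) ^ Suc k"
        unfolding fourier_rho fourier_rho1[OF less_imp_neq[OF True, symmetric]]
        by (simp flip: of_real_power of_real_mult)
      with sums_mult[OF sinh_kernel_sums[OF True, of k], of "exp (- s * v)"]
      have "(\<lambda>N. exp (- s * v) * (real ((N + k) choose k) * (s ^ Suc k * exp (- s * (real (Suc k) / 2 + real N)))))
          sums (exp (- s * v) * Re (fourier (rho (Suc k)) s))" by metis
      moreover have "exp (- s * v) * (real ((N + k) choose k) * (s ^ Suc k * exp (- s * (real (Suc k) / 2 + real N)))) = ?g N s" for N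
      proof -
        have e: "exp (- s * (v + real (Suc k) / 2 + real N)) = exp (- s * v) * exp (- s * (real (Suc k) / 2 + real N))"
          unfolding exp_add[symmetric] by (rule arg_cong[where f = exp]) (simp only: ring_distribs add.assoc)
        show ?thesis unfolding e using True by simp
      qed
      moreover have "?h s = exp (- s * v) * Re (fourier (rho (Suc k)) s)" using True by simp
      ultimately show ?thesis by (simp only:)
    qed simp
  qed
  have hpos: "?h s \<ge> 0" for s
    using h sums_le[of "\<lambda>_. 0" "\<lambda>N. ?g N s" 0 "?h s"] by simp
  have "ennreal ?J = (\<integral>\<^sup>+s. ennreal (?h s) \<partial>lborel)"
    using integral_laplace_fourier[OF integrable_rho[of k] v] integrable_laplace_fourier[OF integrable_rho[of k] v]
      hpos by (subst nn_integral_eq_integral) (auto simp: set_integrable_def set_lebesgue_integral_def)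
  also have "\<dots> = (\<integral>\<^sup>+s. (\<Sum>N. ennreal (?g N s)) \<partial>lborel)"
    using h by (intro nn_integral_cong suminf_ennreal_eq[symmetric])
  also have "\<dots> = (\<Sum>N. \<integral>\<^sup>+s. ennreal (?g N s) \<partial>lborel)"
    by (rule nn_integral_suminf) simp
  also have "(\<lambda>N. \<integral>\<^sup>+s. ennreal (?g N s) \<partial>lborel) = (\<lambda>N. ennreal (?a N))"
  proof
    fix N
    have "(\<integral>\<^sup>+s. ennreal (?g N s) \<partial>lborel) = ennreal (real ((N + k) choose k)) *
       (\<integral>\<^sup>+s. ennreal (indicator {0<..} s * (s ^ Suc k * exp (- s * (v + real (Suc k) / 2 + real N)))) \<partial>lborel)"
      by (subst ennreal_mult') (auto intro!: nn_integral_cmult)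
    also have "\<dots> = ennreal (?a N)"
      unfolding nn_integral_power_exp[OF pos] using pos[of N]
      by (subst ennreal_mult[symmetric]) (auto simp: less_imp_le)
    finally show "(\<integral>\<^sup>+s. ennreal (?g N s) \<partial>lborel) = ennreal (?a N)" .
  qed
  finally have eq: "ennreal ?J = (\<Sum>N. ennreal (?a N))" .
  have a: "?a N \<ge> 0" for N using pos[of N] by simp
  \<comment> \<open>The left-hand side of \<open>eq\<close> is finite, which forces the real series
    to converge.\<close>
  have sa: "summable ?a"
    using summable_suminf_not_top[of ?a] a eq by (metis ennreal_neq_top)
  have "ennreal ?J = ennreal (\<Sum>N. ?a N)"
    using eq suminf_ennreal2[OF a sa] by simp
  then have "?J = (\<Sum>N. ?a N)" using J suminf_nonneg[OF sa a] by (simp add: ennreal_inj)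
  with sa show ?thesis by (simp add: sums_iff)
qed

subsection \<open>Derivatives of a polynomial times the digamma function\<close>

text \<open>By the mean value theorem for \<open>ln_Gamma\<close> on [z, z + 1], ln z is a value of
  the monotone digamma function there; compare it with both endpoints.\<close>

lemma Digamma_real_bounds:
  assumes z: "(z::real) > 0"
  shows "Digamma z \<le> ln z" "ln z \<le> Digamma z + 1 / z"
proof -
  have "\<exists>\<xi>. z < \<xi> \<and> \<xi> < z + 1 \<and> ln_Gamma (z + 1) - ln_Gamma z = (z + 1 - z) * Digamma \<xi>"
    using z by (intro MVT2 derivative_intros) auto
  then obtain \<xi> where \<xi>: "z < \<xi>" "\<xi> < z + 1" "ln_Gamma (z + 1) - ln_Gamma z = Digamma \<xi>"
    by auto
  have "ln_Gamma (z + 1) - ln_Gamma z = ln z"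
  proof -
    have "z \<notin> \<int>\<^sub>\<le>\<^sub>0" using z by (auto elim!: nonpos_Ints_cases)
    then show ?thesis
      using z by (simp add: ln_Gamma_real_pos Gamma_plus1 ln_mult_pos)
  qed
  with \<xi> z Digamma_real_mono[of z \<xi>] Digamma_real_mono[of \<xi> "z + 1"]
  show "Digamma z \<le> ln z" "ln z \<le> Digamma z + 1 / z"
    by (auto simp: Digamma_plus1)
qed

text \<open>The recurrence gives the increment of \<open>Polygamma n\<close> over [z, z + 1]
  exactly, and the mean value theorem makes it a value of \<open>Polygamma (Suc n)\<close>. The sign
  factor makes that function decreasing.\<close>

lemma Polygamma_real_bounds:
  assumes z: "(z::real) > 0"
  shows "fact n / z ^ Suc n \<le> (- 1) ^ n * Polygamma (Suc n) z"
    and "(- 1) ^ n * Polygamma (Suc n) z \<le> fact n / z ^ Suc n + fact (Suc n) / z ^ Suc (Suc n)"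
proof -
  have "\<exists>\<xi>. z < \<xi> \<and> \<xi> < z + 1 \<and> Polygamma n (z + 1) - Polygamma n z = (z + 1 - z) * Polygamma (Suc n) \<xi>"
    using z by (intro MVT2 derivative_intros) (auto elim!: nonpos_Ints_cases)
  then obtain \<xi> where \<xi>: "z < \<xi>" "\<xi> < z + 1" "Polygamma n (z + 1) - Polygamma n z = Polygamma (Suc n) \<xi>"
    by auto
  let ?q = "\<lambda>x::real. (- 1) ^ n * Polygamma (Suc n) x"
  have q: "?q \<xi> = fact n / z ^ Suc n"
    using z unfolding \<xi>(3)[symmetric] by (cases "even n") (simp_all add: Polygamma_plus1)
  have mono: "?q y \<le> ?q x" if "0 < x" "x < y" for x y
  proof (cases "even n")
    case True
    with Polygamma_real_strict_antimono[OF that, of "Suc n"] show ?thesis by simp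
  next
    case False
    with Polygamma_real_strict_mono[OF that, of "Suc n"] show ?thesis by simp
  qed
  have "Polygamma (Suc n) (z + 1) = Polygamma (Suc n) z + (- 1) ^ Suc n * fact (Suc n) / z ^ Suc (Suc n)"
    using z by (intro Polygamma_plus1) simp
  then have "?q (z + 1) = ?q z - fact (Suc n) / z ^ Suc (Suc n)"
    by (cases "even n") (simp_all add: algebra_simps del: fact_Suc power_Suc)
  with q mono[OF z \<xi>(1)] mono[OF less_trans[OF z \<xi>(1)] \<xi>(2)]
  show "fact n / z ^ Suc n \<le> ?q z" "?q z \<le> fact n / z ^ Suc n + fact (Suc n) / z ^ Suc (Suc n)"
    by linarith+
qed

lemma Digamma_minus_ln_tendsto: "((\<lambda>z::real. Digamma z - ln z) \<longlongrightarrow> 0) at_top"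
proof (rule real_tendsto_sandwich)
  show "\<forall>\<^sub>F z::real in at_top. - 1 / z \<le> Digamma z - ln z"
    using eventually_gt_at_top[of 0] by eventually_elim (use Digamma_real_bounds in force)
  show "\<forall>\<^sub>F z::real in at_top. Digamma z - ln z \<le> 0"
    using eventually_gt_at_top[of 0] by eventually_elim (use Digamma_real_bounds in force)
qed (real_asymp, simp)

lemma power_times_Polygamma_tendsto:
  "((\<lambda>z::real. z ^ Suc n * Polygamma (Suc n) z) \<longlongrightarrow> (- 1) ^ n * fact n) at_top"
proof -
  have "((\<lambda>z::real. z ^ Suc n * ((- 1) ^ n * Polygamma (Suc n) z)) \<longlongrightarrow> fact n) at_top"
  proof (rule real_tendsto_sandwich)
    show "\<forall>\<^sub>F z::real in at_top. fact n \<le> z ^ Suc n * ((- 1) ^ n * Polygamma (Suc n) z)"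
      using eventually_gt_at_top[of 0]
    proof eventually_elim
      case (elim z)
      from mult_left_mono[OF Polygamma_real_bounds(1)[OF elim, of n], of "z ^ Suc n"] elim
      show ?case by simp
    qed
    show "\<forall>\<^sub>F z::real in at_top. z ^ Suc n * ((- 1) ^ n * Polygamma (Suc n) z) \<le> fact n + fact (Suc n) / z"
      using eventually_gt_at_top[of 0]
    proof eventually_elim
      case (elim z)
      from mult_left_mono[OF Polygamma_real_bounds(2)[OF elim, of n], of "z ^ Suc n"] elim
      have "z ^ Suc n * ((- 1) ^ n * Polygamma (Suc n) z)
          \<le> z ^ Suc n * (fact n / z ^ Suc n + fact (Suc n) / z ^ Suc (Suc n))" by simp
      also have "\<dots> = fact n + fact (Suc n) / z"
        unfolding distrib_left power_Suc[of z "Suc n"] using elim by (simp del: power_Suc)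
      finally show ?case .
    qed
    show "((\<lambda>z::real. fact n + fact (Suc n) / z) \<longlongrightarrow> fact n) at_top"
      using tendsto_add[OF tendsto_const tendsto_divide_0[OF tendsto_const
            filterlim_at_top_imp_at_infinity[OF filterlim_ident]]]
      by simp
  qed simp
  then have "((\<lambda>z::real. (- 1) ^ n * (z ^ Suc n * ((- 1) ^ n * Polygamma (Suc n) z))) \<longlongrightarrow> (- 1) ^ n * fact n) at_top"
    by (rule tendsto_mult_left)
  moreover have "(- 1) ^ n * (z ^ Suc n * ((- 1) ^ n * Polygamma (Suc n) z)) = z ^ Suc n * Polygamma (Suc n) z" for z :: real
    by (cases "even n") simp_all
  ultimately show ?thesis by (simp only:)
qed

text \<open>This is where the harmonic number in the limit at infinity comes from. Pascal's rule
  splits off an alternating binomial sum, which contributes 1 / (n + 1).\<close>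

lemma sum_alternating_choose_harm:
  "(\<Sum>i<n. real (n choose Suc i) * ((- 1) ^ i / real (Suc i))) = harm n"
proof (induction n)
  case (Suc n)
  have "(\<Sum>i<Suc n. real (Suc n choose Suc i) * ((- 1) ^ i / real (Suc i)))
      = (\<Sum>i<Suc n. real (n choose Suc i) * ((- 1) ^ i / real (Suc i)))
        + (\<Sum>i<Suc n. real (n choose i) * ((- 1) ^ i / real (Suc i)))"
    by (simp only: binomial_Suc_Suc of_nat_add ring_distribs sum.distrib add.commute)
  also have "(\<Sum>i<Suc n. real (n choose Suc i) * ((- 1) ^ i / real (Suc i))) = harm n"
    using Suc.IH by (simp add: binomial_eq_0 del: of_nat_Suc)
  also have "(\<Sum>i<Suc n. real (n choose i) * ((- 1) ^ i / real (Suc i)))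
      = (\<Sum>i<Suc n. real (Suc n choose Suc i) * (- 1) ^ i) / real (Suc n)"
  proof (subst sum_divide_distrib, rule sum.cong[OF refl])
    fix i
    have "real (Suc i) * real (Suc n choose Suc i) = real (Suc n) * real (n choose i)"
      using Suc_times_binomial_eq[of n i] by (metis mult.commute of_nat_mult)
    then show "real (n choose i) * ((- 1) ^ i / real (Suc i)) = real (Suc n choose Suc i) * (- 1) ^ i / real (Suc n)"
      by (simp add: field_simps del: of_nat_Suc binomial_Suc_Suc)
  qed
  also have "(\<Sum>i<Suc n. real (Suc n choose Suc i) * (- 1) ^ i) = 1"
  proof -
    have "0 = (\<Sum>i\<le>Suc n. (- 1) ^ i * real (Suc n choose i))"
      using choose_alternating_sum[of "Suc n", where 'a = real] by simp
    also have "\<dots> = 1 - (\<Sum>i<Suc n. real (Suc n choose Suc i) * (- 1) ^ i)"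
      unfolding sum.atMost_Suc_shift lessThan_Suc_atMost
      by (simp add: mult.commute sum_negf del: binomial_Suc_Suc)
    finally show ?thesis by simp
  qed
  finally show ?case by (simp add: harm_Suc divide_inverse)
qed (simp add: harm_def)

section \<open>Taylor expansion and Leibniz' rule\<close>

lemma pcompose_higher_pderiv_shift:
  fixes p :: "'a :: idom poly"
  shows "(pderiv ^^ i) (pcompose p [:x, 1:]) = pcompose ((pderiv ^^ i) p) [:x, 1:]"
  by (induction i) (simp_all add: pderiv_pcompose pderiv_pCons)

text \<open>The i-th coefficient of p(X + x) is its i-th derivative at 0 over i!, and shifting the
  variable commutes with differentiation.\<close>

lemma poly_taylor:
  fixes p :: "real poly"
  assumes "degree p \<le> n"
  shows "poly p (x + h) = (\<Sum>i\<le>n. poly ((pderiv ^^ i) p) x / fact i * h ^ i)"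
proof -
  let ?q = "pcompose p [:x, 1:]"
  have c: "coeff ?q i = poly ((pderiv ^^ i) p) x / fact i" for i
    using coeff_higher_pderiv[of i ?q 0]
    by (simp add: pcompose_higher_pderiv_shift poly_pcompose flip: poly_0_coeff_0 pochhammer_fact)
  have "poly p (x + h) = poly ?q h" by (simp add: poly_pcompose)
  also have "\<dots> = (\<Sum>i\<le>n. coeff ?q i * h ^ i)"
    using assms unfolding poly_altdef
    by (intro sum.mono_neutral_left) (auto simp: degree_pcompose not_le coeff_eq_0)
  finally show ?thesis unfolding c .
qed

text \<open>The inductive step of Leibniz' rule, with arbitrary sequences in place of the
  derivatives of the two factors; Pascal's rule merges the shifted sums.\<close>

lemma Leibniz_sum_step:
  fixes a b :: "nat \<Rightarrow> real"
  shows "(\<Sum>i\<le>j. real (j choose i) * (a (Suc j - i) * b i + a (j - i) * b (Suc i)))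
    = (\<Sum>i\<le>Suc j. real (Suc j choose i) * (a (Suc j - i) * b i))"
proof -
  have "(\<Sum>i\<le>Suc j. real (Suc j choose i) * (a (Suc j - i) * b i))
      = a (Suc j) * b 0 + (\<Sum>i\<le>j. real (j choose Suc i) * (a (j - i) * b (Suc i)))
        + (\<Sum>i\<le>j. real (j choose i) * (a (j - i) * b (Suc i)))"
    by (subst sum.atMost_Suc_shift) (simp add: ring_distribs sum.distrib)
  also have "a (Suc j) * b 0 + (\<Sum>i\<le>j. real (j choose Suc i) * (a (j - i) * b (Suc i)))
      = (\<Sum>i\<le>Suc j. real (j choose i) * (a (Suc j - i) * b i))"
    by (subst sum.atMost_Suc_shift) simp
  also have "\<dots> = (\<Sum>i\<le>j. real (j choose i) * (a (Suc j - i) * b i))"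
    by simp
  finally show ?thesis by (simp add: ring_distribs sum.distrib)
qed

text \<open>Leibniz' expansion of the j-th derivative of p(x) psi(x - m), where psi is
  \<open>Polygamma 0\<close>.\<close>

definition poly_digamma_deriv :: "real poly \<Rightarrow> nat \<Rightarrow> nat \<Rightarrow> real \<Rightarrow> real" where
  "poly_digamma_deriv p m j x =
    (\<Sum>i\<le>j. real (j choose i) * (poly ((pderiv ^^ (j - i)) p) x * Polygamma i (x - real m)))"

lemma has_derivative_poly_digamma_deriv:
  assumes x: "x > real m"
  shows "(poly_digamma_deriv p m j has_real_derivative poly_digamma_deriv p m (Suc j) x) (at x)"
proof -
  have "x - real m \<notin> \<int>\<^sub>\<le>\<^sub>0" using x by (auto elim!: nonpos_Ints_cases)
  then have "(poly_digamma_deriv p m j has_real_derivative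
     (\<Sum>i\<le>j. real (j choose i) * (poly ((pderiv ^^ (Suc j - i)) p) x * Polygamma i (x - real m)
        + poly ((pderiv ^^ (j - i)) p) x * Polygamma (Suc i) (x - real m)))) (at x)"
    unfolding poly_digamma_deriv_def[abs_def]
    by (auto intro!: derivative_eq_intros sum.cong poly_DERIV simp: Suc_diff_le)
  then show ?thesis
    unfolding Leibniz_sum_step[of j "\<lambda>i. poly ((pderiv ^^ i) p) x" "\<lambda>i. Polygamma i (x - real m)"]
    unfolding poly_digamma_deriv_def .
qed

lemma higher_deriv_poly_Digamma:
  assumes "x > real m"
  shows "(deriv ^^ j) (\<lambda>y. poly p y * Digamma (y - real m)) x = poly_digamma_deriv p m j x"
  using assms
proof (induction j arbitrary: x)
  case (Suc j)
  \<comment> \<open>\<open>deriv\<close> at x depends on the values near x, so the induction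
    hypothesis is used on an open half-line.\<close>
  have "\<forall>\<^sub>F y in nhds x. y \<in> {real m<..}"
    using Suc.prems by (intro eventually_nhds_in_open) auto
  then have "\<forall>\<^sub>F y in nhds x. (deriv ^^ j) (\<lambda>y. poly p y * Digamma (y - real m)) y = poly_digamma_deriv p m j y"
    by eventually_elim (simp add: Suc.IH)
  then have "(deriv ^^ Suc j) (\<lambda>y. poly p y * Digamma (y - real m)) x = deriv (poly_digamma_deriv p m j) x"
    by (simp add: deriv_cong_ev)
  also have "\<dots> = poly_digamma_deriv p m (Suc j) x"
    by (intro DERIV_imp_deriv has_derivative_poly_digamma_deriv Suc.prems)
  finally show ?case .
qed (simp add: poly_digamma_deriv_def)

section \<open>The binomial polynomial\<close>

definition binomial_poly :: "nat \<Rightarrow> real poly" where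
  "binomial_poly k = smult (1 / fact k) (\<Prod>i<k. [:- (1 + real i), 1:])"

lemma poly_binomial_poly: "poly (binomial_poly k) y = (y - 1) gchoose k"
  by (simp add: binomial_poly_def poly_prod gbinomial_prod_rev atLeast0LessThan algebra_simps)

lemma degree_binomial_poly: "degree (binomial_poly k) = k"
  by (simp add: binomial_poly_def degree_prod_sum_eq)

lemma coeff_binomial_poly: "coeff (binomial_poly k) k = 1 / fact k"
proof -
  have "lead_coeff (binomial_poly k) = 1 / fact k"
    unfolding binomial_poly_def lead_coeff_smult lead_coeff_prod by simp
  then show ?thesis by (simp add: degree_binomial_poly)
qed

lemma gchoose_neg_Suc:
  "(- real n - 1 gchoose k) = (- 1) ^ k * real ((n + k) choose k)"
proof -
  have "(- real n - 1 gchoose k) = (- (real n + 1) gchoose k)" by (rule arg_cong[where f = "\<lambda>a. a gchoose k"]) simp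
  also have "\<dots> = (- 1) ^ k * real ((n + k) choose k)"
    by (subst gbinomial_minus) (simp add: binomial_gbinomial)
  finally show ?thesis .
qed

text \<open>At x = v + (k + 1) / 2 this is the series of \<open>rho_cauchy_transform_sums\<close>;
  here the density and the digamma function meet.\<close>

lemma poly_digamma_deriv_binomial_sums:
  fixes x :: real
  assumes m: "m \<le> k" and x: "x > real m"
  shows "(\<lambda>N. real ((N + k) choose k) * fact (Suc k) / (x + real N) ^ Suc (Suc k))
    sums poly_digamma_deriv (binomial_poly k) m (Suc k) x"
proof -
  define p where "p = binomial_poly k"
  define z where "z = x - real m"
  have z: "z > 0" using x by (simp add: z_def)
  define P where "P i = poly ((pderiv ^^ i) p) x" for i
  have deg: "degree p = k" by (simp add: p_def degree_binomial_poly)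
  have "degree ((pderiv ^^ k) p) = 0" by (simp add: degree_higher_pderiv deg)
  then have "pderiv ((pderiv ^^ k) p) = 0" by (subst pderiv_eq_0_iff)
  \<comment> \<open>This kills the summand i = 0, the only one with the digamma function itself,
    whose series is not a plain sum of inverse powers.\<close>
  then have P0: "P (Suc k) = 0" by (simp add: P_def)
  let ?t = "\<lambda>i n. real (Suc k choose i) * (P (Suc k - i) * ((- 1) ^ Suc i * fact i * inverse ((z + real n) ^ Suc i)))"
  have "(\<lambda>n. \<Sum>i\<le>Suc k. ?t i n) sums (\<Sum>i\<le>Suc k. real (Suc k choose i) * (P (Suc k - i) * Polygamma i z))"
  proof (rule sums_sum)
    fix i
    show "?t i sums (real (Suc k choose i) * (P (Suc k - i) * Polygamma i z))"
    proof (cases "i = 0")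
      case False
      from Polygamma_LIMSEQ[of z i] z False
      have "(\<lambda>n. inverse ((z + real n) ^ Suc i)) sums ((- 1) ^ Suc i * Polygamma i z / fact i)" by simp
      from sums_mult[OF this, of "(- 1) ^ Suc i * fact i"]
      have "(\<lambda>n. (- 1) ^ Suc i * fact i * inverse ((z + real n) ^ Suc i)) sums Polygamma i z"
        by (simp add: mult.left_commute[of "fact i"] del: power_Suc flip: power_mult_distrib mult.assoc)
      then show ?thesis by (intro sums_mult)
    qed (simp add: P0)
  qed
  also have "(\<Sum>i\<le>Suc k. real (Suc k choose i) * (P (Suc k - i) * Polygamma i z)) = poly_digamma_deriv p m (Suc k) x"
    by (simp add: poly_digamma_deriv_def P_def z_def)
  also have "(\<lambda>n. \<Sum>i\<le>Suc k. ?t i n) = (\<lambda>n. fact (Suc k) * (- 1) ^ k / (z + real n) ^ Suc (Suc k) * poly p (real m - real n))"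
  proof
    fix n
    \<comment> \<open>Reversed through i = Suc k - r, the sum over i becomes the Taylor expansion of
      p at x with increment - w.\<close>
    define w where "w = z + real n"
    have w: "w > 0" using z by (simp add: w_def)
    have "(\<Sum>i\<le>Suc k. ?t i n) = (\<Sum>r\<le>Suc k. ?t (Suc k - r) n)"
      by (rule sum.nat_diff_reindex[symmetric, of _ "Suc (Suc k)", simplified lessThan_Suc_atMost diff_Suc_Suc])
    also have "\<dots> = (\<Sum>r\<le>Suc k. fact (Suc k) * (- 1) ^ k / w ^ Suc (Suc k) * (P r / fact r * (- w) ^ r))"
    proof (rule sum.cong[OF refl])
      fix r assume "r \<in> {..Suc k}"
      then obtain i where i: "Suc k = r + i" using le_Suc_ex by auto
      have "Suc k - r = i" "Suc k - i = r" using i by auto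
      then have "?t (Suc k - r) n = (real (Suc k choose i) * fact i) * (P r * ((- 1) ^ Suc i * inverse (w ^ Suc i)))"
        by (simp only: w_def mult_ac)
      also have "real (Suc k choose i) * fact i = fact (Suc k) / fact r"
        using binomial_fact[of i "Suc k", where 'a = real] i by simp
      also have "inverse (w ^ Suc i) = w ^ r / w ^ Suc (Suc k)"
        using w unfolding i by (simp add: power_add field_simps)
      \<comment> \<open>As k + 1 = r + i, the numbers i + 1 and k + r have the same parity.\<close>
      also have "(- 1) ^ Suc i = (- 1) ^ k * (- 1 :: real) ^ r"
      proof -
        have "even (Suc i) = even (k + r)" using i by presburger
        then show ?thesis unfolding power_add[symmetric] uminus_power_if by simp
      qed
      finally show "?t (Suc k - r) n = fact (Suc k) * (- 1) ^ k / w ^ Suc (Suc k) * (P r / fact r * (- w) ^ r)"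
        unfolding power_minus[of w r] by (simp add: mult_ac del: power_Suc fact_Suc)
    qed
    also have "\<dots> = fact (Suc k) * (- 1) ^ k / w ^ Suc (Suc k) * poly p (x + - w)"
      unfolding sum_distrib_left[symmetric] P_def by (subst poly_taylor[of p "Suc k"]) (simp_all add: deg)
    also have "x + - w = real m - real n" by (simp add: w_def z_def)
    finally show "(\<Sum>i\<le>Suc k. ?t i n) = fact (Suc k) * (- 1) ^ k / (z + real n) ^ Suc (Suc k) * poly p (real m - real n)"
      by (simp only: w_def)
  qed
  finally have fs: "(\<lambda>n. fact (Suc k) * (- 1) ^ k / (z + real n) ^ Suc (Suc k) * poly p (real m - real n)) sums poly_digamma_deriv p m (Suc k) x"
    (is "?f sums ?s") .
  \<comment> \<open>For \<open>n < m\<close> the number \<open>m - n\<close> is one of the zeros \<open>1, \<dots>, k\<close> of the binomial polynomial, so the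
    shift of the digamma argument by \<open>m\<close> is invisible.\<close>
  have f0: "?f n = 0" if "n < m" for n
  proof -
    have "real m - real n - 1 = real (m - n - 1)" using that by (simp add: of_nat_diff)
    then have "poly p (real m - real n) = real ((m - n - 1) choose k)"
      by (simp add: p_def poly_binomial_poly binomial_gbinomial)
    then show ?thesis using that m by (simp add: binomial_eq_0)
  qed
  from f0 have "(\<Sum>n<m. ?f n) = 0" by (intro sum.neutral) auto
  with fs have "(\<lambda>N. ?f (N + m)) sums ?s"
    using sums_iff_shift[of ?f m ?s] by (simp only: add_0_right)
  \<comment> \<open>After the shift, p is evaluated at - N, where it is (- 1)^k times a binomial
    coefficient; the two signs cancel, and z + N + m = x + N.\<close>
  also have "(\<lambda>N. ?f (N + m)) = (\<lambda>N. real ((N + k) choose k) * fact (Suc k) / (x + real N) ^ Suc (Suc k))"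
    by (rule ext) (simp add: p_def poly_binomial_poly gchoose_neg_Suc z_def del: fact_Suc power_Suc flip: power_mult_distrib)
  finally show ?thesis by (simp only: p_def)
qed

section \<open>The limit at infinity\<close>

lemma poly_over_power_tendsto:
  fixes q :: "real poly"
  assumes "degree q \<le> i"
  shows "((\<lambda>x. poly q x / x ^ i) \<longlongrightarrow> coeff q i) at_top"
proof -
  have "((\<lambda>x. \<Sum>j\<le>i. coeff q j * (x ^ j / x ^ i)) \<longlongrightarrow> (\<Sum>j\<le>i. coeff q j * (if j = i then 1 else 0))) at_top"
  proof (intro tendsto_sum tendsto_mult_left)
    fix j assume "j \<in> {..i}"
    show "((\<lambda>x::real. x ^ j / x ^ i) \<longlongrightarrow> (if j = i then 1 else 0)) at_top"
    proof (cases "j = i")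
      case True
      have "\<forall>\<^sub>F x::real in at_top. 1 = x ^ j / x ^ i"
        using eventually_gt_at_top[of "0::real"] by eventually_elim (simp add: True)
      from Lim_transform_eventually[OF tendsto_const this] True show ?thesis by simp
    next
      case False
      with \<open>j \<in> {..i}\<close> obtain d where d: "i = j + Suc d"
        using less_imp_Suc_add[of j i] by auto
      have "((\<lambda>x::real. 1 / x ^ Suc d) \<longlongrightarrow> 0) at_top"
        by (intro tendsto_divide_0[OF tendsto_const] filterlim_at_top_imp_at_infinity filterlim_pow_at_top filterlim_ident) simp
      moreover have "\<forall>\<^sub>F x::real in at_top. 1 / x ^ Suc d = x ^ j / x ^ i"
        using eventually_gt_at_top[of "0::real"] by eventually_elim (simp add: d power_add)
      ultimately show ?thesis using False by (simp add: Lim_transform_eventually)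
    qed
  qed
  moreover have "(\<Sum>j\<le>i. coeff q j * (x ^ j / x ^ i)) = poly q x / x ^ i" for x
  proof -
    have "poly q x = (\<Sum>j\<le>i. coeff q j * x ^ j)"
      using assms unfolding poly_altdef
      by (intro sum.mono_neutral_left) (auto simp: not_le coeff_eq_0)
    then show ?thesis by (simp add: sum_divide_distrib)
  qed
  ultimately show ?thesis by (simp add: if_distrib[of "\<lambda>c. _ * c"] cong: if_cong)
qed

text \<open>The k-th derivative of the polynomial is 1, so the digamma term of Leibniz' expansion
  cancels the logarithm asymptotically. In every other term the growth of the polynomial factor
  matches the decay of the polygamma factor.\<close>

lemma ln_minus_poly_digamma_deriv_tendsto:
  "((\<lambda>x. ln (x - real m) - poly_digamma_deriv (binomial_poly k) m k x) \<longlongrightarrow> - harm k) at_top"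
proof -
  define p where "p = binomial_poly k"
  have deg: "degree p = k" by (simp add: p_def degree_binomial_poly)
  have coeff: "coeff ((pderiv ^^ (k - i)) p) i = 1 / fact i" if "i \<le> k" for i
  proof -
    have "pochhammer (real (Suc i)) (k - i) = fact k / fact i"
      using pochhammer_product[OF that, of "1::real"] by (simp add: pochhammer_fact[symmetric])
    then show ?thesis
      using that by (simp add: coeff_higher_pderiv p_def coeff_binomial_poly)
  qed
  have shift: "filterlim (\<lambda>x. x - real m) at_top at_top"
    by real_asymp
  have q: "((\<lambda>x. x / (x - real m)) \<longlongrightarrow> 1) at_top"
    by real_asymp
  have p_lim: "((\<lambda>x. poly ((pderiv ^^ (k - Suc i)) p) x / x ^ Suc i) \<longlongrightarrow> 1 / fact (Suc i)) at_top" if "i < k" for i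
    using poly_over_power_tendsto[of "(pderiv ^^ (k - Suc i)) p" "Suc i"] coeff[of "Suc i"] that
    by (simp add: degree_higher_pderiv deg del: power_Suc fact_Suc)
  \<comment> \<open>Each summand is rewritten as a product of three factors with finite limits,
    correcting for the shift from x to x - m by powers of x / (x - m).\<close>
  have "((\<lambda>x. (Digamma (x - real m) - ln (x - real m))
      + (\<Sum>i<k. real (k choose Suc i) * ((poly ((pderiv ^^ (k - Suc i)) p) x / x ^ Suc i)
          * (x / (x - real m)) ^ Suc i * ((x - real m) ^ Suc i * Polygamma (Suc i) (x - real m)))))
    \<longlongrightarrow> 0 + (\<Sum>i<k. real (k choose Suc i) * (1 / fact (Suc i) * 1 ^ Suc i * ((- 1) ^ i * fact i)))) at_top"
    by (intro tendsto_add tendsto_sum tendsto_mult[OF tendsto_const]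
        tendsto_mult[OF tendsto_mult[OF p_lim tendsto_power[OF q]]]
        filterlim_compose[OF Digamma_minus_ln_tendsto shift]
        filterlim_compose[OF power_times_Polygamma_tendsto shift]) simp
  moreover have "(\<Sum>i<k. real (k choose Suc i) * (1 / fact (Suc i) * 1 ^ Suc i * ((- 1) ^ i * fact i))) = harm k"
    unfolding sum_alternating_choose_harm[symmetric]
    by (intro sum.cong refl arg_cong[where f = "\<lambda>c. _ * c"]) (simp del: of_nat_Suc)
  moreover have "\<forall>\<^sub>F x in at_top. (Digamma (x - real m) - ln (x - real m))
      + (\<Sum>i<k. real (k choose Suc i) * ((poly ((pderiv ^^ (k - Suc i)) p) x / x ^ Suc i)
          * (x / (x - real m)) ^ Suc i * ((x - real m) ^ Suc i * Polygamma (Suc i) (x - real m))))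
      = poly_digamma_deriv p m k x - ln (x - real m)"
    using eventually_gt_at_top[of "real m"]
  proof eventually_elim
    case (elim x)
    then have x: "x > 0" "x - real m > 0" by linarith+
    have "degree ((pderiv ^^ k) p) = 0" by (simp add: degree_higher_pderiv deg)
    then obtain c where c: "(pderiv ^^ k) p = [:c:]" by (rule degree_eq_zeroE)
    with coeff[of 0] have "poly ((pderiv ^^ k) p) x = 1" by simp
    then have "poly_digamma_deriv p m k x = Digamma (x - real m)
        + (\<Sum>i<k. real (k choose Suc i) * (poly ((pderiv ^^ (k - Suc i)) p) x * Polygamma (Suc i) (x - real m)))"
      unfolding poly_digamma_deriv_def lessThan_Suc_atMost[symmetric] sum.lessThan_Suc_shift by simp
    moreover have "a / x ^ Suc i * (x / (x - real m)) ^ Suc i * ((x - real m) ^ Suc i * b) = a * b" for i a b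
      using x by (simp add: power_divide del: power_Suc)
    ultimately show ?case by (simp del: power_Suc)
  qed
  ultimately have "((\<lambda>x. poly_digamma_deriv p m k x - ln (x - real m)) \<longlongrightarrow> harm k) at_top"
    by (simp add: Lim_transform_eventually)
  from tendsto_minus[OF this] show ?thesis by (simp add: p_def)
qed

subsection \<open>The logarithmic integral\<close>

lemma integral_rho: "(LINT t|lborel. rho (Suc n) t) = 1"
proof -
  have "Re (fourier (rho (Suc n)) 0) = 1"
    unfolding fourier_rho fourier_rho1_0 by simp
  then show ?thesis by (simp add: Re_fourier integrable_rho)
qed

text \<open>The integrand equals 1 / v - v / (v^2 + t^2), whose antiderivative ln v - ln (v^2 + t^2)
  / 2 vanishes at infinity.\<close>

lemma nn_integral_ln_kernel:
  fixes y t :: real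
  assumes y: "y > 0"
  shows "(\<integral>\<^sup>+v. ennreal (t\<^sup>2 / (v * (v\<^sup>2 + t\<^sup>2))) * indicator {y..} v \<partial>lborel) = ennreal (ln (1 + t\<^sup>2 / y\<^sup>2) / 2)"
proof -
  have "(\<integral>\<^sup>+v. ennreal (t\<^sup>2 / (v * (v\<^sup>2 + t\<^sup>2))) * indicator {y..} v \<partial>lborel)
      = ennreal (0 - (ln y - ln (y\<^sup>2 + t\<^sup>2) / 2))"
  proof (rule nn_integral_FTC_atLeast)
    fix v assume "y \<le> v"
    with y have v: "v > 0" by simp
    have vt: "v\<^sup>2 + t\<^sup>2 > 0" using v by (intro add_pos_nonneg) auto
    have "((\<lambda>v. ln (v\<^sup>2 + t\<^sup>2)) has_real_derivative (2 * v) / (v\<^sup>2 + t\<^sup>2)) (at v)"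
      using vt by (auto intro!: derivative_eq_intros)
    note D = DERIV_diff[OF DERIV_ln[OF v] DERIV_cdivide[OF this, of 2]]
    have "((\<lambda>v. ln v - ln (v\<^sup>2 + t\<^sup>2) / 2) has_real_derivative 1 / v - v / (v\<^sup>2 + t\<^sup>2)) (at v)"
    proof -
      have half: "2 * v / K / 2 = v / K" for K :: real by simp
      from D show ?thesis unfolding inverse_eq_divide half .
    qed
    also have "1 / v - v / (v\<^sup>2 + t\<^sup>2) = t\<^sup>2 / (v * (v\<^sup>2 + t\<^sup>2))"
      using v vt by (simp add: field_simps power2_eq_square)
    finally show "((\<lambda>v. ln v - ln (v\<^sup>2 + t\<^sup>2) / 2) has_real_derivative t\<^sup>2 / (v * (v\<^sup>2 + t\<^sup>2))) (at v)" .
    show "0 \<le> t\<^sup>2 / (v * (v\<^sup>2 + t\<^sup>2))" using v by simp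
  next
    show "((\<lambda>v. ln v - ln (v\<^sup>2 + t\<^sup>2) / 2) \<longlongrightarrow> 0) at_top"
      by real_asymp
  qed simp
  also have "0 - (ln y - ln (y\<^sup>2 + t\<^sup>2) / 2) = ln (1 + t\<^sup>2 / y\<^sup>2) / 2"
  proof -
    have "y\<^sup>2 + t\<^sup>2 > 0" using y by (intro add_pos_nonneg) auto
    moreover have "1 + t\<^sup>2 / y\<^sup>2 = (y\<^sup>2 + t\<^sup>2) / y\<^sup>2" using y by (simp add: add_divide_distrib)
    ultimately show ?thesis using y by (simp add: ln_div ln_realpow)
  qed
  finally show ?thesis .
qed

text \<open>The kernel is 1 / v minus the Cauchy kernel, and \<open>rho (Suc k)\<close> has mass 1.
  Nonnegativity of the kernel gives the inequality.\<close>

lemma nn_integral_rho_kernel: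
  fixes v :: real
  assumes v: "v > 0"
  shows "(\<integral>\<^sup>+t. ennreal (rho (Suc k) t * (t\<^sup>2 / (v * (v\<^sup>2 + t\<^sup>2)))) \<partial>lborel)
      = ennreal (1 / v - (LINT t|lborel. rho (Suc k) t * (v / (v\<^sup>2 + t\<^sup>2))))" (is ?A)
    and "(LINT t|lborel. rho (Suc k) t * (v / (v\<^sup>2 + t\<^sup>2))) \<le> 1 / v" (is ?B)
proof -
  have vt: "v\<^sup>2 + t\<^sup>2 > 0" for t using v by (intro add_pos_nonneg) auto
  have eq: "t\<^sup>2 / (v * (v\<^sup>2 + t\<^sup>2)) = 1 / v - v / (v\<^sup>2 + t\<^sup>2)" for t
    using v vt[of t] by (simp add: field_simps power2_eq_square)
  have int: "integrable lborel (\<lambda>t. rho (Suc k) t * (v / (v\<^sup>2 + t\<^sup>2)))"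
  proof (rule Bochner_Integration.integrable_bound[OF integrable_mult_left[OF integrable_rho[of k], of "1 / v"]])
    have "v / (v\<^sup>2 + t\<^sup>2) \<le> 1 / v" for t using eq[of t] v vt[of t] 
      by (metis diff_ge_0_iff_ge divide_nonneg_pos mult_pos_pos zero_le_power2)
    then show "AE t in lborel. norm (rho (Suc k) t * (v / (v\<^sup>2 + t\<^sup>2))) \<le> norm (rho (Suc k) t * (1 / v))"
      using v vt unfolding norm_mult by (intro AE_I2 mult_left_mono) (auto simp: less_imp_le)
  qed (use v in measurable)
  have diff: "(\<lambda>t. rho (Suc k) t * (t\<^sup>2 / (v * (v\<^sup>2 + t\<^sup>2))))
      = (\<lambda>t. rho (Suc k) t * (1 / v) - rho (Suc k) t * (v / (v\<^sup>2 + t\<^sup>2)))"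
    unfolding eq by (simp add: right_diff_distrib)
  have int2: "integrable lborel (\<lambda>t. rho (Suc k) t * (1 / v) - rho (Suc k) t * (v / (v\<^sup>2 + t\<^sup>2)))"
    by (intro Bochner_Integration.integrable_diff integrable_mult_left integrable_rho int)
  have I: "(LINT t|lborel. rho (Suc k) t * (1 / v) - rho (Suc k) t * (v / (v\<^sup>2 + t\<^sup>2)))
      = 1 / v - (LINT t|lborel. rho (Suc k) t * (v / (v\<^sup>2 + t\<^sup>2)))"
    by (subst Bochner_Integration.integral_diff[OF integrable_mult_left[OF integrable_rho] int])
      (simp add: integral_rho del: rho.simps)
  have nn: "0 \<le> rho (Suc k) t * (t\<^sup>2 / (v * (v\<^sup>2 + t\<^sup>2)))" for t
    using v by (intro mult_nonneg_nonneg rho_nonneg) auto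
  have "(\<integral>\<^sup>+t. ennreal (rho (Suc k) t * (t\<^sup>2 / (v * (v\<^sup>2 + t\<^sup>2)))) \<partial>lborel)
      = ennreal (LINT t|lborel. rho (Suc k) t * (t\<^sup>2 / (v * (v\<^sup>2 + t\<^sup>2))))"
    using nn int2 unfolding diff[symmetric] by (intro nn_integral_eq_integral AE_I2)
  then show ?A by (simp only: diff I)
  have "0 \<le> (LINT t|lborel. rho (Suc k) t * (t\<^sup>2 / (v * (v\<^sup>2 + t\<^sup>2))))"
    using nn by (intro Bochner_Integration.integral_nonneg)
  then show ?B by (simp only: diff I diff_ge_0_iff_ge)
qed

text \<open>Since g vanishes at 0, the overlap of the two closed half-lines does no harm to the
  pointwise splitting.\<close>

lemma integral_even:
  fixes g :: "real \<Rightarrow> real"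
  assumes g: "integrable lborel g" and even: "\<And>t. g (- t) = g t" and g0: "g 0 = 0"
  shows "(LBINT t:{0..}. g t) = (LINT t|lborel. g t / 2)"
proof -
  have int: "integrable lborel (\<lambda>t. indicator {0..} t * g t)"
    using integrable_real_mult_indicator[OF _ g, of "{0..}"] by (simp add: mult.commute)
  have "(LINT t|lborel. g t) = (LINT t|lborel. indicator {0..} t * g t + indicator {0..} (- t) * g (- t))"
    using even g0 by (intro Bochner_Integration.integral_cong) (auto simp: indicator_def)
  also have "\<dots> = (LINT t|lborel. indicator {0..} t * g t) + (LINT t|lborel. indicator {0..} (- t) * g (- t))"
    using int lborel_integrable_real_affine[OF int, of "- 1" 0]
    by (intro Bochner_Integration.integral_add) auto
  also have "(LINT t|lborel. indicator {0..} (- t) * g (- t)) = (LINT t|lborel. indicator {0..} t * g t)"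
    using lborel_integral_real_affine[of "- 1" "\<lambda>t. indicator {0..} t * g t" 0] by simp
  finally show ?thesis by (simp add: set_lebesgue_integral_def)
qed

text \<open>Nonnegativity accompanies the value because \<open>ennreal\<close> sends negative reals
  to 0; it allows the return to a real integral.\<close>

lemma nn_integral_ln_rho:
  fixes y :: real and k :: nat
  assumes y: "y > 0"
  defines "m \<equiv> Suc k div 2" and "c \<equiv> real (Suc k) / 2"
  shows "(\<integral>\<^sup>+t. ennreal (rho (Suc k) t * (ln (1 + t\<^sup>2 / y\<^sup>2) / 2)) \<partial>lborel)
    = ennreal (- harm k - (ln y - poly_digamma_deriv (binomial_poly k) m k (y + c)))" (is ?eq)
    and "0 \<le> - harm k - (ln y - poly_digamma_deriv (binomial_poly k) m k (y + c))" (is ?nonneg)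
proof -
  \<comment> \<open>This keeps the digamma argument v + c - m positive for all v > 0.\<close>
  have mc: "real m \<le> c" using of_nat_div_le_of_nat[of "Suc k" 2, where 'a = real] by (simp add: m_def c_def)
  have mk: "m \<le> k" by (simp add: m_def)
  let ?A = "\<lambda>v. poly_digamma_deriv (binomial_poly k) m k (v + c)"
  let ?R = "\<lambda>v. LINT t|lborel. rho (Suc k) t * (v / (v\<^sup>2 + t\<^sup>2))"
  let ?h = "\<lambda>t v. rho (Suc k) t * (t\<^sup>2 / (v * (v\<^sup>2 + t\<^sup>2)))"
  \<comment> \<open>Both series have the same terms at v + c, so \<open>?R\<close> is the derivative
    of \<open>?A\<close>.\<close>
  have R: "?R v = poly_digamma_deriv (binomial_poly k) m (Suc k) (v + c)" if "v > 0" for v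
  proof -
    have "real m < v + c" using that mc by simp
    from sums_unique2[OF rho_cauchy_transform_sums[OF that, of k]
        poly_digamma_deriv_binomial_sums[OF mk this, unfolded c_def]]
    show ?thesis unfolding c_def .
  qed
  have D: "((\<lambda>v. ln v - ?A v) has_real_derivative 1 / v - ?R v) (at v)" if "v \<ge> y" for v
  proof -
    from that y have v: "v > 0" by simp
    have "(?A has_real_derivative ?R v) (at v)"
      unfolding R[OF v] DERIV_shift[symmetric]
      using v mc by (intro has_derivative_poly_digamma_deriv) simp
    with v show ?thesis
      by (auto intro!: derivative_eq_intros simp del: rho.simps)
  qed
  have D_nonneg: "0 \<le> 1 / v - ?R v" if "v \<ge> y" for v
    using nn_integral_rho_kernel(2)[of v k] that y by simp
  \<comment> \<open>The limit lemma has the logarithm at v + c - m; replacing it by ln v changes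
    nothing in the limit.\<close>
  have "((\<lambda>v. ln (v + c - real m) - ?A v) \<longlongrightarrow> - harm k) at_top"
    by (rule filterlim_compose[OF ln_minus_poly_digamma_deriv_tendsto]) real_asymp
  moreover have "((\<lambda>v. ln v - ln (v + c - real m)) \<longlongrightarrow> 0) at_top"
    by real_asymp
  ultimately have "((\<lambda>v. (ln v - ln (v + c - real m)) + (ln (v + c - real m) - ?A v)) \<longlongrightarrow> 0 + - harm k) at_top"
    by (intro tendsto_add)
  then have lim: "((\<lambda>v. ln v - ?A v) \<longlongrightarrow> - harm k) at_top" by simp
  \<comment> \<open>The derivative 1 / v - R(v) is nonnegative, so the value at y lies below the
    limit at infinity.\<close>
  have "\<forall>\<^sub>F v in at_top. ln y - ?A y \<le> ln v - ?A v"
    using eventually_ge_at_top[of y]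
  proof eventually_elim
    case (elim v)
    then show ?case
      by (rule DERIV_nonneg_imp_nondecreasing) (use D D_nonneg in blast)
  qed
  from tendsto_lowerbound[OF lim this] show ?nonneg by simp
  have "(\<integral>\<^sup>+t. ennreal (rho (Suc k) t * (ln (1 + t\<^sup>2 / y\<^sup>2) / 2)) \<partial>lborel)
      = (\<integral>\<^sup>+t. \<integral>\<^sup>+v. ennreal (?h t v) * indicator {y..} v \<partial>lborel \<partial>lborel)"
  proof (intro nn_integral_cong)
    fix t
    have "ennreal (rho (Suc k) t * (ln (1 + t\<^sup>2 / y\<^sup>2) / 2)) = ennreal (rho (Suc k) t) * ennreal (ln (1 + t\<^sup>2 / y\<^sup>2) / 2)"
      by (rule ennreal_mult'[OF rho_nonneg])
    also have "\<dots> = (\<integral>\<^sup>+v. ennreal (rho (Suc k) t) * (ennreal (t\<^sup>2 / (v * (v\<^sup>2 + t\<^sup>2))) * indicator {y..} v) \<partial>lborel)"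
      unfolding nn_integral_ln_kernel[OF y, symmetric] by (rule nn_integral_cmult[symmetric]) measurable
    also have "\<dots> = (\<integral>\<^sup>+v. ennreal (?h t v) * indicator {y..} v \<partial>lborel)"
      by (simp only: ennreal_mult'[OF rho_nonneg] mult.assoc)
    finally show "ennreal (rho (Suc k) t * (ln (1 + t\<^sup>2 / y\<^sup>2) / 2))
      = (\<integral>\<^sup>+v. ennreal (?h t v) * indicator {y..} v \<partial>lborel)" .
  qed
  \<comment> \<open>In this order the inner integral is 1 / v - R(v), for which an antiderivative is
    known.\<close>
  also have "\<dots> = (\<integral>\<^sup>+v. \<integral>\<^sup>+t. ennreal (?h t v) * indicator {y..} v \<partial>lborel \<partial>lborel)"
    by (rule lborel_pair.Fubini'[symmetric]) measurable
  also have "\<dots> = (\<integral>\<^sup>+v. ennreal (1 / v - ?R v) * indicator {y..} v \<partial>lborel)"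
  proof (intro nn_integral_cong)
    fix v
    show "(\<integral>\<^sup>+t. ennreal (?h t v) * indicator {y..} v \<partial>lborel) = ennreal (1 / v - ?R v) * indicator {y..} v"
      using y nn_integral_rho_kernel(1)[of v k] by (cases "y \<le> v") (simp_all del: rho.simps)
  qed
  also have "\<dots> = ennreal (- harm k - (ln y - ?A y))"
    by (rule nn_integral_FTC_atLeast[OF _ D D_nonneg lim]) measurable
  finally show ?eq .
qed

theorem theorem1p3:
  fixes l :: nat and x b :: real
  assumes "l > 0" and "x > real l / 2"
    and "b = 1 / (x - real l / 2) ^ 2"
  shows "set_integrable lborel {0..} (\<lambda>u. ln (1 + b * u ^ 2) * rho l u)
    \<and> (LBINT u:{0..}. ln (1 + b * u ^ 2) * rho l u)
      = - ln \<bar>x - real l / 2\<bar> - harm (l - 1)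
        + (deriv ^^ (l - 1))
            (\<lambda>y. ((y - 1) gchoose (l - 1)) * Digamma (y - real (l div 2))) x"
proof -
  obtain k where l: "l = Suc k" using assms(1) by (cases l) auto
  define y where "y = x - real l / 2"
  have y: "y > 0" using assms by (simp add: y_def)
  have b: "b = 1 / y\<^sup>2" using assms by (simp add: y_def)
  define m where "m = Suc k div 2"
  have xm: "x > real m"
    using assms(2) of_nat_div_le_of_nat[of "Suc k" 2, where 'a = real] by (simp add: m_def l)
  let ?D = "poly_digamma_deriv (binomial_poly k) m k x"
  let ?g = "\<lambda>u. ln (1 + b * u ^ 2) * rho l u"
  let ?J = "- harm k - (ln y - ?D)"
  have b_pos: "1 + b * u\<^sup>2 \<ge> 1" for u by (simp add: b)
  then have g_nonneg: "?g u \<ge> 0" for u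
    unfolding l by (intro mult_nonneg_nonneg rho_nonneg) auto
  have [measurable]: "?g \<in> borel_measurable borel"
    unfolding l by measurable
  \<comment> \<open>The integrand is even, so half of it over the whole line gives the integral over
    the half-line.\<close>
  have nn: "(\<integral>\<^sup>+u. ennreal (?g u / 2) \<partial>lborel) = ennreal ?J"
    using nn_integral_ln_rho[OF y, of k] by (simp add: l b y_def m_def mult.commute del: rho.simps)
  have "integrable lborel (\<lambda>u. ?g u / 2)"
    using nn g_nonneg by (intro integrableI_nn_integral_finite) auto
  from integrable_mult_right[OF this, of 2] have int: "integrable lborel ?g" by simp
  have "ennreal (LINT u|lborel. ?g u / 2) = (\<integral>\<^sup>+u. ennreal (?g u / 2) \<partial>lborel)"
    using int g_nonneg by (intro nn_integral_eq_integral[symmetric]) auto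
  also note nn
  finally have "(LINT u|lborel. ?g u / 2) = ?J"
    using nn_integral_ln_rho(2)[OF y, of k] g_nonneg
    by (subst (asm) ennreal_inj) (auto simp: l y_def m_def intro!: Bochner_Integration.integral_nonneg simp del: rho.simps)
  moreover have "(LBINT u:{0..}. ?g u) = (LINT u|lborel. ?g u / 2)"
    using int by (rule integral_even) (simp_all add: l rho_minus del: rho.simps)
  moreover have "set_integrable lborel {0..} ?g"
    using integrable_mult_indicator[OF _ int, of "{0..}"] by (simp add: set_integrable_def)
  moreover have "(deriv ^^ k) (\<lambda>y. ((y - 1) gchoose k) * Digamma (y - real m)) x = ?D"
    using higher_deriv_poly_Digamma[OF xm, of k "binomial_poly k"] by (simp add: poly_binomial_poly)
  ultimately show ?thesis
    using y by (simp add: l y_def m_def del: rho.simps)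
qed

end
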